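(* Let $P\in\mathrm{Diff}^m(\mathcal N;E)$, $m\ge 1$, commute with its formal adjoint and with $\mathcal L_{\mathcal T}$, suppose that there is a real line $\Lambda\subset\mathbb C$ through the origin such that $\sigma(P)+\sigma(-i\mathcal L_{\mathcal T})^m-\lambda I$ is invertible (at every point of $T^*\mathcal N\setminus 0$) if $\lambda\in\Lambda$, and suppose that the Hermitian metric $h$ of $E$ and the density $\mathfrak m$ are $\mathcal T$-invariant. Suppose in addition that $A=P+(-i\mathcal L_{\mathcal T})^m$ is positive. Then $$N(\tau)\le w_A|\tau|^{\dim\mathcal N}+o(\tau^{\dim\mathcal N})\quad\text{as }\tau\to\infty,$$ where $w_A$ is the coefficient in Weyl's eigenvalue estimate for $A$.
   Context: $\mathcal N$ is a compact $C^\infty$ manifold without boundary, $\mathcal T$ is a smooth nowhere vanishing real vector field on $\mathcal N$, and $E\to\mathcal N$ is a complex vector bundle with Hermitian metric $h$. $\mathfrak m$ is a smooth positive density on $\mathcal N$. $\mathcal L_{\mathcal T}:C^\infty(\mathcal N;E)\to C^\infty(\mathcal N;E)$ is a first order differential operator with $\mathcal L_{\mathcal T}(f\phi)=f\mathcal L_{\mathcal T}\phi+(\mathcal Tf)\phi$ for $f\in C^\infty(\mathcal N)$, $\phi\in C^\infty(\mathcal N;E)$. The metric $h$ is $\mathcal T$-invariant if $\mathcal T h(\phi,\psi)=h(\mathcal L_{\mathcal T}\phi,\psi)+h(\phi,\mathcal L_{\mathcal T}\psi)$ for all $\phi,\psi\in C^\infty(\mathcal N;E)$; $\mathfrak m$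 is $\mathcal T$-invariant if it is invariant under the flow of $\mathcal T$. $L^2(\mathcal N;E)$ has inner product $(\phi,\psi)=\int_{\mathcal N}h(\phi,\psi)\,d\mathfrak m$, and formal adjoints and positivity are with respect to it. $\mathrm{Diff}^m(\mathcal N;E)$ is the space of differential operators of order $m$ with smooth coefficients acting on sections of $E$; $\sigma(\cdot)$ denotes the principal symbol ($\sigma(P)$ is the symbol of order $m$). $\ker P$ is the kernel of $P$ in $L^2(\mathcal N;E)$. Let $\mathscr D=\{\phi\in\ker P:\mathcal L_{\mathcal T}\phi\in L^2(\mathcal N;E)\}$. Under the stated hypotheses the operator $-i\mathcal L_{\mathcal T}|_{\mathscr D}:\mathscr D\subset\ker P\to\ker P$ is selfadjoint with compact resolvent; its spectrum, denoted $\mathrm{spec}_0(-i\mathcal L_{\mathcal T})$, is a discrete subset of $\mathbb R$ without finite accumulation points, and its eigenspaces $$\mathcal E_\tau=\{\phi\in C^\infty(\mathcal N;E): P\phi=0,\ \mathcal L_{\mathcal T}\phi=i\tau\phi\}$$ are finite-dimensional. The counting function is $$N(\tau)=\sum_{\tau_0\in\mathrm{spec}_0(-i\mathcal L_{\mathcal T}),\ |\tau_0|<\tau}\dim\mathcal E_{\tau_0}.$$ The number $w_A$ is the coefficient in Weyl's estimate for the elliptic operator $A$ of order $m$: $$\sum_{\lambda'<\lambda}\dim\ker(A-\lambda' I)\sim w_A\lambda^{\dim\mathcal N/m}\quad\text{as }\lambda\to\infty,$$ the sum being over the eigenvalues $\lambda'$ of $A$. *)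

theory Defs
  imports "HOL-Analysis.Analysis" "HOL-Library.Function_Algebras" "HOL-Library.Landau_Symbols"
begin

section \<open>Smooth maps between Euclidean spaces\<close>

text \<open>Meant for open \<open>S\<close> in a finite-dimensional domain, where a map is of class \<open>C\<^sup>k\<^sup>+\<^sup>1\<close> iff it is
  differentiable and all its directional derivatives are of class \<open>C\<^sup>k\<close>.\<close>

primrec Ck_on :: "nat \<Rightarrow> 'x::real_normed_vector set \<Rightarrow> ('x \<Rightarrow> 'y::real_normed_vector) \<Rightarrow> bool" where
  "Ck_on 0 S f \<longleftrightarrow> continuous_on S f"
| "Ck_on (Suc k) S f \<longleftrightarrow>
     f differentiable_on S \<and> (\<forall>v. Ck_on k S (\<lambda>x. frechet_derivative f (at x) v))"

definition smooth_on :: "'x::real_normed_vector set \<Rightarrow> ('x \<Rightarrow> 'y::real_normed_vector) \<Rightarrow> bool" where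
  "smooth_on S f \<longleftrightarrow> (\<forall>k. Ck_on k S f)"

text \<open>For a word \<open>I = [i\<^sub>1,\<dots>,i\<^sub>k]\<close> in the coordinate indices, the iterated partial derivative
  \<open>\<partial>\<^bsub>i\<^sub>1\<^esub> \<cdots> \<partial>\<^bsub>i\<^sub>k\<^esub> f\<close>.  Words replace multi-indices, so that no ordering of the index type is needed.\<close>

definition partial_word :: "'n list \<Rightarrow> (real^'n \<Rightarrow> 'y::real_normed_vector) \<Rightarrow> real^'n \<Rightarrow> 'y" where
  "partial_word I f = foldr (\<lambda>i g y. frechet_derivative g (at y) (axis i 1)) I f"


section \<open>Hermitian vector bundles over compact manifolds with density\<close>

text \<open>The points of the base manifold are the elements of the type \<open>'a\<close> and its dimension is
  \<open>CARD('n)\<close>.  The fibres of the bundle are arbitrary complex vector spaces of dimension \<open>CARD('k)\<close>,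
  one for each point, realised as subspaces of one type \<open>'v\<close> that is a complex vector space under
  \<open>scl\<close> but carries no topology (any family of vector spaces embeds into its direct sum).  The smooth
  structure of the bundle comes from the local trivializations only.\<close>

record ('a, 'n, 'v, 'k) hbundle =
  charts :: "('a set \<times> ('a \<Rightarrow> real^'n::finite)) set"
  scl :: "complex \<Rightarrow> 'v \<Rightarrow> 'v"
  fibre :: "'a \<Rightarrow> 'v set"
  trivs :: "('a set \<times> ('a \<Rightarrow> 'v \<Rightarrow> complex^'k::finite)) set"
  herm :: "'a \<Rightarrow> 'v \<Rightarrow> 'v \<Rightarrow> complex"
  dens :: "'a measure"

definition compact_manifold :: "('a::t2_space, 'n::finite, 'v, 'k::finite) hbundle \<Rightarrow> bool" where
  "compact_manifold G \<longleftrightarrow>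
     compact (UNIV :: 'a set) \<and>
     (\<Union>(U, \<kappa>)\<in>charts G. U) = UNIV \<and>
     (\<forall>(U, \<kappa>)\<in>charts G. open U \<and> open (\<kappa> ` U) \<and> homeomorphism U (\<kappa> ` U) \<kappa> (inv_into U \<kappa>)) \<and>
     (\<forall>(U, \<kappa>)\<in>charts G. \<forall>(U', \<kappa>')\<in>charts G. smooth_on (\<kappa> ` (U \<inter> U')) (\<kappa>' \<circ> inv_into U \<kappa>))"

definition smooth_fun ::
  "('a, 'n::finite, 'v, 'k::finite) hbundle \<Rightarrow> ('a \<Rightarrow> 'y::real_normed_vector) \<Rightarrow> bool" where
  "smooth_fun G f \<longleftrightarrow> (\<forall>(U, \<kappa>)\<in>charts G. smooth_on (\<kappa> ` U) (f \<circ> inv_into U \<kappa>))"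

definition vector_bundle ::
  "('a::t2_space, 'n::finite, 'v::ab_group_add, 'k::finite) hbundle \<Rightarrow> bool" where
  "vector_bundle G \<longleftrightarrow>
     vector_space (scl G) \<and>
     (\<forall>x. module.subspace (scl G) (fibre G x)) \<and>
     (\<Union>(V, \<Phi>)\<in>trivs G. V) = UNIV \<and>
     (\<forall>(V, \<Phi>)\<in>trivs G. open V \<and>
        (\<forall>x\<in>V. bij_betw (\<Phi> x) (fibre G x) UNIV \<and>
           (\<forall>u\<in>fibre G x. \<forall>v\<in>fibre G x. \<Phi> x (u + v) = \<Phi> x u + \<Phi> x v) \<and>
           (\<forall>c. \<forall>u\<in>fibre G x. \<Phi> x (scl G c u) = c *s \<Phi> x u))) \<and>
     (\<forall>(V, \<Phi>)\<in>trivs G. \<forall>(V', \<Phi>')\<in>trivs G. \<forall>(U, \<kappa>)\<in>charts G. \<forall>e.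
        smooth_on (\<kappa> ` (U \<inter> V \<inter> V'))
          (\<lambda>y. let x = inv_into U \<kappa> y in \<Phi>' x (inv_into (fibre G x) (\<Phi> x) e)))"

text \<open>The representation of a section in a chart \<open>c\<close> and a local trivialization \<open>t\<close>, and the open set
  of \<open>\<real>\<^sup>n\<close> on which it is meaningful.\<close>

definition ldom :: "('a set \<times> ('a \<Rightarrow> real^'n)) \<Rightarrow> ('a set \<times> ('a \<Rightarrow> 'v \<Rightarrow> complex^'k)) \<Rightarrow> (real^'n) set" where
  "ldom c t = snd c ` (fst c \<inter> fst t)"

definition lrep :: "('a set \<times> ('a \<Rightarrow> real^'n)) \<Rightarrow> ('a set \<times> ('a \<Rightarrow> 'v \<Rightarrow> complex^'k)) \<Rightarrow>
    ('a \<Rightarrow> 'v) \<Rightarrow> real^'n \<Rightarrow> complex^'k" where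
  "lrep c t \<phi> y = (let x = inv_into (fst c) (snd c) y in snd t x (\<phi> x))"

definition smooth_sections ::
  "('a, 'n::finite, 'v, 'k::finite) hbundle \<Rightarrow> ('a \<Rightarrow> 'v) set" where
  "smooth_sections G =
     {\<phi>. (\<forall>x. \<phi> x \<in> fibre G x) \<and> (\<forall>c\<in>charts G. \<forall>t\<in>trivs G. smooth_on (ldom c t) (lrep c t \<phi>))}"

definition hermitian_metric ::
  "('a, 'n::finite, 'v::ab_group_add, 'k::finite) hbundle \<Rightarrow> bool" where
  "hermitian_metric G \<longleftrightarrow>
     (\<forall>x. \<forall>u\<in>fibre G x. \<forall>v\<in>fibre G x. \<forall>w\<in>fibre G x.
        herm G x (u + v) w = herm G x u w + herm G x v w) \<and>
     (\<forall>x. \<forall>u\<in>fibre G x. \<forall>v\<in>fibre G x. \<forall>c.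
        herm G x (scl G c u) v = c * herm G x u v) \<and>
     (\<forall>x. \<forall>u\<in>fibre G x. \<forall>v\<in>fibre G x. herm G x v u = cnj (herm G x u v)) \<and>
     (\<forall>x. \<forall>u\<in>fibre G x. u \<noteq> 0 \<longrightarrow> 0 < Re (herm G x u u)) \<and>
     (\<forall>\<phi>\<in>smooth_sections G. \<forall>\<psi>\<in>smooth_sections G. smooth_fun G (\<lambda>x. herm G x (\<phi> x) (\<psi> x)))"

text \<open>A smooth positive density, given as the Borel measure it defines.\<close>

definition smooth_density :: "('a::t2_space, 'n::finite, 'v, 'k::finite) hbundle \<Rightarrow> bool" where
  "smooth_density G \<longleftrightarrow>
     sets (dens G) = sets borel \<and>
     (\<forall>(U, \<kappa>)\<in>charts G. \<exists>\<rho> :: real^'n \<Rightarrow> real.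
        smooth_on (\<kappa> ` U) \<rho> \<and> (\<forall>y\<in>\<kappa> ` U. 0 < \<rho> y) \<and>
        (\<forall>B\<in>sets borel. B \<subseteq> U \<longrightarrow>
           emeasure (dens G) B = (\<integral>\<^sup>+y\<in>\<kappa> ` B. ennreal (\<rho> y) \<partial>lborel)))"

definition hermitian_bundle ::
  "('a::t2_space, 'n::finite, 'v::ab_group_add, 'k::finite) hbundle \<Rightarrow> bool" where
  "hermitian_bundle G \<longleftrightarrow>
     compact_manifold G \<and> vector_bundle G \<and> hermitian_metric G \<and> smooth_density G"


section \<open>Vector fields and their flows\<close>

text \<open>Smooth real vector fields as derivations of the algebra of smooth real functions.  Only the
  values on smooth functions matter.\<close>

definition vector_field ::
  "('a, 'n::finite, 'v, 'k::finite) hbundle \<Rightarrow> (('a \<Rightarrow> real) \<Rightarrow> 'a \<Rightarrow> real) \<Rightarrow> bool" where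
  "vector_field G T \<longleftrightarrow>
     (\<forall>f. smooth_fun G f \<longrightarrow> smooth_fun G (T f)) \<and>
     (\<forall>f g a b. smooth_fun G f \<longrightarrow> smooth_fun G g \<longrightarrow>
        T (\<lambda>x. a * f x + b * g x) = (\<lambda>x. a * T f x + b * T g x)) \<and>
     (\<forall>f g. smooth_fun G f \<longrightarrow> smooth_fun G g \<longrightarrow>
        T (\<lambda>x. f x * g x) = (\<lambda>x. f x * T g x + g x * T f x))"

definition nowhere_vanishing ::
  "('a, 'n::finite, 'v, 'k::finite) hbundle \<Rightarrow> (('a \<Rightarrow> real) \<Rightarrow> 'a \<Rightarrow> real) \<Rightarrow> bool" where
  "nowhere_vanishing G T \<longleftrightarrow> (\<forall>x. \<exists>f. smooth_fun G f \<and> T f x \<noteq> 0)"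

definition complexify :: "(('a \<Rightarrow> real) \<Rightarrow> 'a \<Rightarrow> real) \<Rightarrow> ('a \<Rightarrow> complex) \<Rightarrow> 'a \<Rightarrow> complex" where
  "complexify T f x = Complex (T (\<lambda>z. Re (f z)) x) (T (\<lambda>z. Im (f z)) x)"

text \<open>The flow is global because the manifold is compact, and it is determined by the vector field.\<close>

definition is_flow ::
  "('a, 'n::finite, 'v, 'k::finite) hbundle \<Rightarrow> (('a \<Rightarrow> real) \<Rightarrow> 'a \<Rightarrow> real) \<Rightarrow> (real \<Rightarrow> 'a \<Rightarrow> 'a) \<Rightarrow> bool" where
  "is_flow G T \<theta> \<longleftrightarrow>
     (\<forall>x. \<theta> 0 x = x) \<and>
     (\<forall>f. smooth_fun G f \<longrightarrow>
        (\<forall>x t. ((\<lambda>s. f (\<theta> s x)) has_real_derivative T f (\<theta> t x)) (at t)))"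

definition density_invariant ::
  "('a::t2_space, 'n::finite, 'v, 'k::finite) hbundle \<Rightarrow> (('a \<Rightarrow> real) \<Rightarrow> 'a \<Rightarrow> real) \<Rightarrow> bool" where
  "density_invariant G T \<longleftrightarrow> (\<exists>\<theta>. is_flow G T \<theta> \<and> (\<forall>t. distr (dens G) borel (\<theta> t) = dens G))"


section \<open>Differential operators\<close>

text \<open>Operators are functions on all maps \<open>'a \<Rightarrow> 'v\<close>; only their values on smooth sections matter.\<close>

type_synonym ('a, 'v) sop = "('a \<Rightarrow> 'v) \<Rightarrow> 'a \<Rightarrow> 'v"

definition sscale ::
  "('a, 'n::finite, 'v, 'k::finite) hbundle \<Rightarrow> complex \<Rightarrow> ('a \<Rightarrow> 'v) \<Rightarrow> 'a \<Rightarrow> 'v" where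
  "sscale G c \<phi> = (\<lambda>x. scl G c (\<phi> x))"

text \<open>\<open>a\<close> is a system of smooth coefficients for \<open>P\<close> over the domain of \<open>c\<close> and \<open>t\<close>:
  \<open>P = \<Sum>\<^bsub>|I| \<le> m\<^esub> a\<^bsub>I\<^esub> \<partial>\<^bsub>I\<^esub>\<close>.  It is not unique, since mixed partial derivatives are not collected.\<close>

definition local_coeffs ::
  "('a, 'n::finite, 'v, 'k::finite) hbundle \<Rightarrow> nat \<Rightarrow> ('a, 'v) sop \<Rightarrow>
   ('a set \<times> ('a \<Rightarrow> real^'n)) \<Rightarrow> ('a set \<times> ('a \<Rightarrow> 'v \<Rightarrow> complex^'k)) \<Rightarrow>
   ('n list \<Rightarrow> real^'n \<Rightarrow> complex^'k^'k) \<Rightarrow> bool" where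
  "local_coeffs G m P c t a \<longleftrightarrow>
     (\<forall>I. length I \<le> m \<longrightarrow> smooth_on (ldom c t) (a I)) \<and>
     (\<forall>\<phi>\<in>smooth_sections G. \<forall>y\<in>ldom c t.
        lrep c t (P \<phi>) y = (\<Sum>I | length I \<le> m. a I y *v partial_word I (lrep c t \<phi>) y))"

definition diff_ops ::
  "('a, 'n::finite, 'v::ab_group_add, 'k::finite) hbundle \<Rightarrow> nat \<Rightarrow> ('a, 'v) sop set" where
  "diff_ops G m =
     {P. (\<forall>\<phi>\<in>smooth_sections G. P \<phi> \<in> smooth_sections G) \<and>
         (\<forall>\<phi>\<in>smooth_sections G. \<forall>\<psi>\<in>smooth_sections G. P (\<phi> + \<psi>) = P \<phi> + P \<psi>) \<and>
         (\<forall>b. \<forall>\<phi>\<in>smooth_sections G. P (sscale G b \<phi>) = sscale G b (P \<phi>)) \<and>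
         (\<forall>c\<in>charts G. \<forall>t\<in>trivs G. \<exists>a. local_coeffs G m P c t a)}"

text \<open>The principal symbol of order \<open>m\<close>, \<open>v \<mapsto> \<Sum>\<^bsub>|I| = m\<^esub> (\<i>\<xi>)\<^sup>I a\<^bsub>I\<^esub>(x) v\<close>, in the chart \<open>c\<close> and the
  trivialization \<open>t\<close>, at the covector \<open>\<Sum>\<^sub>j \<xi>\<^sub>j dx\<^sub>j\<close> at the point with coordinates \<open>y\<close>.  The sum does not
  depend on the choice of the coefficients.\<close>

definition psymbol ::
  "('a, 'n::finite, 'v, 'k::finite) hbundle \<Rightarrow> nat \<Rightarrow> ('a, 'v) sop \<Rightarrow>
   ('a set \<times> ('a \<Rightarrow> real^'n)) \<Rightarrow> ('a set \<times> ('a \<Rightarrow> 'v \<Rightarrow> complex^'k)) \<Rightarrow>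
   real^'n \<Rightarrow> real^'n \<Rightarrow> complex^'k \<Rightarrow> complex^'k" where
  "psymbol G m P c t y \<xi> v =
     (let a = (SOME a. local_coeffs G m P c t a)
      in \<Sum>I | length I = m. prod_list (map (\<lambda>i. \<i> * of_real (\<xi> $ i)) I) *s (a I y *v v))"

definition lie_operator ::
  "('a, 'n::finite, 'v::ab_group_add, 'k::finite) hbundle \<Rightarrow>
   (('a \<Rightarrow> real) \<Rightarrow> 'a \<Rightarrow> real) \<Rightarrow> ('a, 'v) sop \<Rightarrow> bool" where
  "lie_operator G T L \<longleftrightarrow>
     L \<in> diff_ops G 1 \<and>
     (\<forall>f \<phi>. smooth_fun G f \<longrightarrow> \<phi> \<in> smooth_sections G \<longrightarrow>
        L (\<lambda>x. scl G (f x) (\<phi> x)) =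
          (\<lambda>x. scl G (f x) (L \<phi> x) + scl G (complexify T f x) (\<phi> x)))"

definition metric_invariant ::
  "('a, 'n::finite, 'v, 'k::finite) hbundle \<Rightarrow>
   (('a \<Rightarrow> real) \<Rightarrow> 'a \<Rightarrow> real) \<Rightarrow> ('a, 'v) sop \<Rightarrow> bool" where
  "metric_invariant G T L \<longleftrightarrow>
     (\<forall>\<phi>\<in>smooth_sections G. \<forall>\<psi>\<in>smooth_sections G.
        complexify T (\<lambda>x. herm G x (\<phi> x) (\<psi> x)) =
          (\<lambda>x. herm G x (L \<phi> x) (\<psi> x) + herm G x (\<phi> x) (L \<psi> x)))"

definition Dop :: "('a, 'n::finite, 'v, 'k::finite) hbundle \<Rightarrow> ('a, 'v) sop \<Rightarrow> ('a, 'v) sop" where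
  "Dop G L \<phi> = sscale G (-\<i>) (L \<phi>)"

definition Aop ::
  "('a, 'n::finite, 'v::ab_group_add, 'k::finite) hbundle \<Rightarrow> nat \<Rightarrow> ('a, 'v) sop \<Rightarrow> ('a, 'v) sop \<Rightarrow> ('a, 'v) sop" where
  "Aop G m P L \<phi> = P \<phi> + (Dop G L ^^ m) \<phi>"

definition symbol_condition ::
  "('a, 'n::finite, 'v, 'k::finite) hbundle \<Rightarrow> nat \<Rightarrow> ('a, 'v) sop \<Rightarrow> ('a, 'v) sop \<Rightarrow> complex set \<Rightarrow> bool" where
  "symbol_condition G m P L \<Lambda> \<longleftrightarrow>
     (\<forall>\<mu>\<in>\<Lambda>. \<forall>c\<in>charts G. \<forall>t\<in>trivs G. \<forall>y\<in>ldom c t. \<forall>\<xi>. \<xi> \<noteq> 0 \<longrightarrow>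
        bij (\<lambda>v. psymbol G m P c t y \<xi> v + (psymbol G 1 (Dop G L) c t y \<xi> ^^ m) v - \<mu> *s v))"

definition real_line_through_0 :: "complex set \<Rightarrow> bool" where
  "real_line_through_0 \<Lambda> \<longleftrightarrow> (\<exists>z. z \<noteq> 0 \<and> \<Lambda> = range (\<lambda>s::real. of_real s * z))"


section \<open>The Hilbert space of square integrable sections\<close>

text \<open>Elements of \<open>L\<^sup>2\<close> are represented by measurable sections; equality in \<open>L\<^sup>2\<close> is equality almost
  everywhere and is written out where it is needed.\<close>

definition L2_sections ::
  "('a::t2_space, 'n::finite, 'v, 'k::finite) hbundle \<Rightarrow> ('a \<Rightarrow> 'v) set" where
  "L2_sections G =
     {\<phi>. (\<forall>x. \<phi> x \<in> fibre G x) \<and>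
         (\<forall>(V, \<Phi>)\<in>trivs G. (\<lambda>x. \<Phi> x (\<phi> x)) \<in> borel_measurable (restrict_space (dens G) V)) \<and>
         integrable (dens G) (\<lambda>x. herm G x (\<phi> x) (\<phi> x))}"

definition ip ::
  "('a, 'n::finite, 'v, 'k::finite) hbundle \<Rightarrow> ('a \<Rightarrow> 'v) \<Rightarrow> ('a \<Rightarrow> 'v) \<Rightarrow> complex" where
  "ip G \<phi> \<psi> = (\<integral>x. herm G x (\<phi> x) (\<psi> x) \<partial>dens G)"

definition L2_norm ::
  "('a, 'n::finite, 'v, 'k::finite) hbundle \<Rightarrow> ('a \<Rightarrow> 'v) \<Rightarrow> real" where
  "L2_norm G \<phi> = sqrt (Re (ip G \<phi> \<phi>))"

definition formal_adjoint ::
  "('a, 'n::finite, 'v, 'k::finite) hbundle \<Rightarrow> ('a, 'v) sop \<Rightarrow> ('a, 'v) sop" where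
  "formal_adjoint G Q \<psi> =
     (THE u. u \<in> smooth_sections G \<and> (\<forall>\<phi>\<in>smooth_sections G. ip G (Q \<phi>) \<psi> = ip G \<phi> u))"

definition commute_on_smooth ::
  "('a, 'n::finite, 'v, 'k::finite) hbundle \<Rightarrow> ('a, 'v) sop \<Rightarrow> ('a, 'v) sop \<Rightarrow> bool" where
  "commute_on_smooth G P Q \<longleftrightarrow> (\<forall>\<phi>\<in>smooth_sections G. P (Q \<phi>) = Q (P \<phi>))"

definition positive_op ::
  "('a, 'n::finite, 'v, 'k::finite) hbundle \<Rightarrow> ('a, 'v) sop \<Rightarrow> bool" where
  "positive_op G Q \<longleftrightarrow> (\<forall>\<phi>\<in>smooth_sections G. ip G (Q \<phi>) \<phi> \<in> \<real> \<and> 0 \<le> Re (ip G (Q \<phi>) \<phi>))"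

text \<open>\<open>Q\<phi> = u\<close> in the sense of distributions.\<close>

definition weak_eq ::
  "('a, 'n::finite, 'v, 'k::finite) hbundle \<Rightarrow> ('a, 'v) sop \<Rightarrow> ('a \<Rightarrow> 'v) \<Rightarrow> ('a \<Rightarrow> 'v) \<Rightarrow> bool" where
  "weak_eq G Q \<phi> u \<longleftrightarrow> (\<forall>\<psi>\<in>smooth_sections G. ip G \<phi> (formal_adjoint G Q \<psi>) = ip G u \<psi>)"

definition L2_ker ::
  "('a::t2_space, 'n::finite, 'v::zero, 'k::finite) hbundle \<Rightarrow> ('a, 'v) sop \<Rightarrow> ('a \<Rightarrow> 'v) set" where
  "L2_ker G P = {\<phi>\<in>L2_sections G. weak_eq G P \<phi> (\<lambda>x. 0)}"


section \<open>The spectrum of \<open>-\<i>L\<close> on the kernel of \<open>P\<close> and the counting functions\<close>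

text \<open>The graph of \<open>L\<close>, in the sense of distributions, over \<open>\<D> = {\<phi> \<in> ker P. L\<phi> \<in> L\<^sup>2}\<close>.\<close>

definition LT_graph ::
  "('a::t2_space, 'n::finite, 'v::zero, 'k::finite) hbundle \<Rightarrow> ('a, 'v) sop \<Rightarrow> ('a, 'v) sop \<Rightarrow>
   (('a \<Rightarrow> 'v) \<times> ('a \<Rightarrow> 'v)) set" where
  "LT_graph G P L = {(\<phi>, u). \<phi> \<in> L2_ker G P \<and> u \<in> L2_sections G \<and> weak_eq G L \<phi> u}"

text \<open>The resolvent set: \<open>-\<i>L - \<mu> : \<D> \<rightarrow> ker P\<close> is injective, and surjective with bounded inverse.\<close>

definition resolvent0 ::
  "('a::t2_space, 'n::finite, 'v::ab_group_add, 'k::finite) hbundle \<Rightarrow> ('a, 'v) sop \<Rightarrow> ('a, 'v) sop \<Rightarrow>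
   complex set" where
  "resolvent0 G P L =
     {\<mu>. (\<forall>(\<phi>, u)\<in>LT_graph G P L.
             (AE x in dens G. scl G (-\<i>) (u x) - scl G \<mu> (\<phi> x) = 0) \<longrightarrow> (AE x in dens G. \<phi> x = 0)) \<and>
         (\<exists>C. \<forall>f\<in>L2_ker G P. \<exists>(\<phi>, u)\<in>LT_graph G P L.
             (AE x in dens G. scl G (-\<i>) (u x) - scl G \<mu> (\<phi> x) = f x) \<and>
             L2_norm G \<phi> \<le> C * L2_norm G f)}"

definition spec0 ::
  "('a::t2_space, 'n::finite, 'v::ab_group_add, 'k::finite) hbundle \<Rightarrow> ('a, 'v) sop \<Rightarrow> ('a, 'v) sop \<Rightarrow>
   complex set" where
  "spec0 G P L = - resolvent0 G P L"

definition joint_eigenspace ::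
  "('a, 'n::finite, 'v::zero, 'k::finite) hbundle \<Rightarrow> ('a, 'v) sop \<Rightarrow> ('a, 'v) sop \<Rightarrow> complex \<Rightarrow>
   ('a \<Rightarrow> 'v) set" where
  "joint_eigenspace G P L \<tau> =
     {\<phi>\<in>smooth_sections G. P \<phi> = (\<lambda>x. 0) \<and> L \<phi> = sscale G (\<i> * \<tau>) \<phi>}"

text \<open>The dimension of a subspace of the space of sections, \<open>\<infinity>\<close> in the infinite-dimensional case (where
  \<^const>\<open>vector_space.dim\<close> is \<open>0\<close>).  Together with \<^const>\<open>infsum\<close> in \<^typ>\<open>ennreal\<close>, this keeps the counting
  functions below meaningful without knowing in advance that they are finite.\<close>

definition edim ::
  "('a, 'n::finite, 'v::ab_group_add, 'k::finite) hbundle \<Rightarrow> ('a \<Rightarrow> 'v) set \<Rightarrow> ennreal" where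
  "edim G S =
     (if \<exists>B. finite B \<and> S \<subseteq> module.span (sscale G) B
      then of_nat (vector_space.dim (sscale G) S) else \<infinity>)"

definition N0 ::
  "('a::t2_space, 'n::finite, 'v::ab_group_add, 'k::finite) hbundle \<Rightarrow> ('a, 'v) sop \<Rightarrow> ('a, 'v) sop \<Rightarrow>
   real \<Rightarrow> ennreal" where
  "N0 G P L \<tau> = (\<Sum>\<^sub>\<infinity>\<tau>\<^sub>0 | \<tau>\<^sub>0 \<in> spec0 G P L \<and> cmod \<tau>\<^sub>0 < \<tau>. edim G (joint_eigenspace G P L \<tau>\<^sub>0))"

definition eigenspace ::
  "('a, 'n::finite, 'v, 'k::finite) hbundle \<Rightarrow> ('a, 'v) sop \<Rightarrow> real \<Rightarrow> ('a \<Rightarrow> 'v) set" where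
  "eigenspace G A \<mu> = {\<phi>\<in>smooth_sections G. A \<phi> = sscale G (of_real \<mu>) \<phi>}"

definition eigenvalues ::
  "('a, 'n::finite, 'v::zero, 'k::finite) hbundle \<Rightarrow> ('a, 'v) sop \<Rightarrow> real set" where
  "eigenvalues G A = {\<mu>. \<exists>\<phi>\<in>eigenspace G A \<mu>. \<phi> \<noteq> (\<lambda>x. 0)}"

definition eigen_count ::
  "('a, 'n::finite, 'v::ab_group_add, 'k::finite) hbundle \<Rightarrow> ('a, 'v) sop \<Rightarrow> real \<Rightarrow> ennreal" where
  "eigen_count G A \<mu> = (\<Sum>\<^sub>\<infinity>\<mu>' | \<mu>' \<in> eigenvalues G A \<and> \<mu>' < \<mu>. edim G (eigenspace G A \<mu>'))"

text \<open>\<open>w\<close> is the coefficient in Weyl's estimate for \<open>A\<close>, an operator of order \<open>m\<close>.\<close>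

definition weyl_coefficient ::
  "('a, 'n::finite, 'v::ab_group_add, 'k::finite) hbundle \<Rightarrow> nat \<Rightarrow> ('a, 'v) sop \<Rightarrow> real \<Rightarrow> bool" where
  "weyl_coefficient G m A w \<longleftrightarrow>
     (\<forall>\<mu>. eigen_count G A \<mu> < \<infinity>) \<and>
     (\<lambda>\<mu>. enn2real (eigen_count G A \<mu>)) \<sim>[at_top] (\<lambda>\<mu>. w * \<mu> powr (real CARD('n) / real m))"

end

theory Submission
  imports Defs
begin

text \<open>
  A joint eigensection \<open>P\<phi> = 0\<close>, \<open>L\<phi> = \<i>\<tau>\<phi>\<close> satisfies \<open>A\<phi> = P\<phi> + (-\<i>L)\<^sup>m\<phi> = \<tau>\<^sup>m\<phi>\<close>, so it is an
  eigensection of \<open>A\<close>, and \<open>|\<tau>| < \<tau>\<^sub>1\<close> forces \<open>\<tau>\<^sup>m < \<tau>\<^sub>1\<^sup>m\<close>.  Hence the joint eigenspaces counted by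
  \<open>N(\<tau>\<^sub>1)\<close> lie in the eigenspaces of \<open>A\<close> with eigenvalues below \<open>\<tau>\<^sub>1\<^sup>m\<close>.  Two values \<open>\<plusminus>\<tau>\<close> may land in
  the same eigenspace of \<open>A\<close> when \<open>m\<close> is even, but eigenspaces of \<open>L\<close> for distinct eigenvalues are
  linearly independent, so dimensions still add up.  This gives the inequality \<open>N0_le_eigen_count\<close>,
  \<open>N(\<tau>) \<le> N\<^sub>A(\<tau>\<^sup>m)\<close> with \<open>N\<^sub>A\<close> the counting function of \<open>A\<close>, and Weyl's estimate turns its
  right-hand side into \<open>w\<^sub>A (\<tau>\<^sup>m)\<^bsup>n/m\<^esup> + o(\<tau>\<^sup>n) = w\<^sub>A \<tau>\<^sup>n + o(\<tau>\<^sup>n)\<close>, where \<open>n\<close> is the dimension of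
  the manifold.

  This argument presupposes that \<open>\<tau>\<close> is real.  A point of the spectrum without joint eigensections
  contributes \<open>0\<close> to \<open>N\<close>, so what must be excluded is a nonreal \<open>\<tau>\<close> with a joint eigensection
  \<open>\<phi> \<noteq> 0\<close> (\<open>joint_eigenvalue_real\<close>).  Invariance of the metric gives
  \<open>T h(\<phi>,\<phi>) = -2 (Im \<tau>) h(\<phi>,\<phi>)\<close>.  By compactness \<open>h(\<phi>,\<phi>)\<close> has a maximum, which is positive; the
  derivative along the flow vanishes there, so \<open>Im \<tau> = 0\<close>.
\<close>


section \<open>Smooth functions\<close>

text \<open>Openness makes the derivative at each point of \<open>S\<close> depend on the values on \<open>S\<close> only.  This
  allows a local representation of a section to be replaced by a formula valid on its domain.\<close>

lemma Ck_on_cong_open: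
  assumes "open S" "\<And>x. x \<in> S \<Longrightarrow> f x = g x" "Ck_on k S f"
  shows "Ck_on k S g"
  using assms(2,3)
proof (induction k arbitrary: f g)
  case 0
  then show ?case using continuous_on_cong[of S S f g] by simp
next
  case (Suc k)
  have der: "frechet_derivative f (at x) = frechet_derivative g (at x)"
    and dif: "g differentiable (at x)" if "x \<in> S" for x
  proof -
    have "f differentiable (at x)"
      using Suc.prems(2) that assms(1) by (simp add: differentiable_on_eq_differentiable_at)
    then have "(f has_derivative frechet_derivative f (at x)) (at x)"
      by (simp add: frechet_derivative_works)
    then have "(g has_derivative frechet_derivative f (at x)) (at x)"
      by (rule has_derivative_transform_within_open[OF _ assms(1) that]) (use Suc.prems(1) in auto)
    then show "frechet_derivative f (at x) = frechet_derivative g (at x)"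
      and "g differentiable (at x)"
      by (auto simp: frechet_derivative_at differentiable_def)
  qed
  have "Ck_on k S (\<lambda>x. frechet_derivative g (at x) v)" for v
    by (rule Suc.IH[of "\<lambda>x. frechet_derivative f (at x) v"]) (use der Suc.prems(2) in auto)
  then show ?case
    using dif assms(1) by (simp add: differentiable_on_eq_differentiable_at)
qed

lemma Ck_on_bounded_linear:
  assumes "open S" "bounded_linear h" "Ck_on k S f"
  shows "Ck_on k S (\<lambda>x. h (f x))"
  using assms(3)
proof (induction k arbitrary: f)
  case 0
  then show ?case
    using bounded_linear.continuous_on[OF assms(2)] by simp
next
  case (Suc k)
  have D: "((\<lambda>x. h (f x)) has_derivative (\<lambda>v. h (frechet_derivative f (at x) v))) (at x)"
    if "x \<in> S" for x
  proof -
    have "f differentiable (at x)"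
      using Suc.prems that assms(1) by (simp add: differentiable_on_eq_differentiable_at)
    then have "(f has_derivative frechet_derivative f (at x)) (at x)"
      by (simp add: frechet_derivative_works)
    then show ?thesis by (rule bounded_linear.has_derivative[OF assms(2)])
  qed
  have "Ck_on k S (\<lambda>x. frechet_derivative (\<lambda>x. h (f x)) (at x) v)" for v
  proof (rule Ck_on_cong_open[OF assms(1)])
    show "Ck_on k S (\<lambda>x. h (frechet_derivative f (at x) v))"
      using Suc by simp
    show "h (frechet_derivative f (at x) v) = frechet_derivative (\<lambda>x. h (f x)) (at x) v"
      if "x \<in> S" for x
      using frechet_derivative_at[OF D[OF that]] by metis
  qed
  moreover have "(\<lambda>x. h (f x)) differentiable_on S"
    using D assms(1) by (auto simp: differentiable_on_eq_differentiable_at differentiable_def)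
  ultimately show ?case by simp
qed

lemma Ck_on_add:
  assumes "open S" "Ck_on k S f" "Ck_on k S g"
  shows "Ck_on k S (\<lambda>x. f x + g x)"
  using assms(2,3)
proof (induction k arbitrary: f g)
  case 0
  then show ?case by (simp add: continuous_on_add)
next
  case (Suc k)
  have D: "((\<lambda>x. f x + g x) has_derivative
      (\<lambda>v. frechet_derivative f (at x) v + frechet_derivative g (at x) v)) (at x)"
    if "x \<in> S" for x
    using Suc.prems that assms(1)
    by (intro has_derivative_add)
      (simp_all add: differentiable_on_eq_differentiable_at frechet_derivative_works)
  have "Ck_on k S (\<lambda>x. frechet_derivative (\<lambda>x. f x + g x) (at x) v)" for v
  proof (rule Ck_on_cong_open[OF assms(1)])
    show "Ck_on k S (\<lambda>x. frechet_derivative f (at x) v + frechet_derivative g (at x) v)"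
      using Suc by simp
    show "frechet_derivative f (at x) v + frechet_derivative g (at x) v
        = frechet_derivative (\<lambda>x. f x + g x) (at x) v"
      if "x \<in> S" for x
      using frechet_derivative_at[OF D[OF that]] by metis
  qed
  moreover have "(\<lambda>x. f x + g x) differentiable_on S"
    using D assms(1) by (auto simp: differentiable_on_eq_differentiable_at differentiable_def)
  ultimately show ?case by simp
qed

lemma open_chart_image:
  assumes "compact_manifold G" "(U, \<kappa>) \<in> charts G" "open V"
  shows "open (\<kappa> ` (U \<inter> V))"
proof -
  have hom: "homeomorphism U (\<kappa> ` U) \<kappa> (inv_into U \<kappa>)" and op: "open (\<kappa> ` U)" "open U"
    using assms(1,2) by (auto simp: compact_manifold_def)
  have "openin (top_of_set (\<kappa> ` U)) (\<kappa> ` (U \<inter> V))"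
    by (rule homeomorphism_imp_open_map[OF hom]) (use assms(3) in auto)
  then show ?thesis using op(1) openin_open_trans by blast
qed

text \<open>Vector fields and their flows act on real functions, whereas the pairing of two sections is
  complex-valued.\<close>

lemma smooth_fun_Re:
  assumes "compact_manifold G" "smooth_fun G f"
  shows "smooth_fun G (\<lambda>x. Re (f x))"
proof -
  have "smooth_on (\<kappa> ` U) ((\<lambda>x. Re (f x)) \<circ> inv_into U \<kappa>)" if "(U, \<kappa>) \<in> charts G" for U \<kappa>
  proof -
    have "open (\<kappa> ` U)" using open_chart_image[OF assms(1) that, of UNIV] by simp
    moreover have "Ck_on k (\<kappa> ` U) (f \<circ> inv_into U \<kappa>)" for k
      using assms(2) that by (auto simp: smooth_fun_def smooth_on_def)
    ultimately show ?thesis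
      by (auto simp: smooth_on_def o_def intro: Ck_on_bounded_linear[OF _ bounded_linear_Re])
  qed
  then show ?thesis by (auto simp: smooth_fun_def)
qed

lemma continuous_smooth_fun:
  fixes G :: "('a::t2_space, 'n::finite, 'v, 'k::finite) hbundle"
  assumes "compact_manifold G" "smooth_fun G f"
  shows "continuous_on UNIV f"
proof -
  have "continuous_on U f" "open U" if "(U, \<kappa>) \<in> charts G" for U \<kappa>
  proof -
    have hom: "homeomorphism U (\<kappa> ` U) \<kappa> (inv_into U \<kappa>)"
      using assms(1) that by (auto simp: compact_manifold_def)
    show "open U" using assms(1) that by (auto simp: compact_manifold_def)
    have "Ck_on 0 (\<kappa> ` U) (f \<circ> inv_into U \<kappa>)"
      using assms(2) that unfolding smooth_fun_def smooth_on_def by blast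
    then have "continuous_on U ((f \<circ> inv_into U \<kappa>) \<circ> \<kappa>)"
      using hom by (auto simp: homeomorphism_def intro: continuous_on_compose simp del: o_apply)
    then show "continuous_on U f"
      by (rule continuous_on_eq) (use hom in \<open>auto simp: homeomorphism_def\<close>)
  qed
  then have "continuous_on (\<Union>p\<in>charts G. fst p) f"
    by (intro continuous_on_open_UN) auto
  moreover have "(\<Union>p\<in>charts G. fst p) = UNIV"
    using assms(1) unfolding compact_manifold_def by (auto simp: case_prod_unfold)
  ultimately show ?thesis by simp
qed


section \<open>The vector space of smooth sections\<close>

lemma vector_space_sscale:
  assumes "vector_bundle G"
  shows "vector_space (sscale G)"
proof -
  interpret F: vector_space "scl G" using assms by (simp add: vector_bundle_def)
  show ?thesis
    by unfold_locales
      (auto simp: sscale_def fun_eq_iff F.scale_right_distrib F.scale_left_distrib)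
qed

lemma bounded_linear_vector_scalar_mult: "bounded_linear (\<lambda>v :: complex^'k. c *s v)"
  unfolding linear_conv_bounded_linear[symmetric]
  by (rule linearI) (simp_all add: vec_eq_iff distrib_left)

text \<open>Trivializations are linear on fibres, so the local representation of a linear combination is
  the linear combination of the local representations.  Closure under sums matters because
  differential operators are linear on smooth sections only.\<close>

lemma subspace_smooth_sections:
  assumes "compact_manifold G" "vector_bundle G"
  shows "module.subspace (sscale G) (smooth_sections G)"
proof -
  interpret F: vector_space "scl G" using assms(2) by (simp add: vector_bundle_def)
  interpret S: vector_space "sscale G" using assms(2) by (rule vector_space_sscale)
  have fib: "F.subspace (fibre G x)" for x using assms(2) by (simp add: vector_bundle_def)
  have op: "open (ldom c t)" if "c \<in> charts G" "t \<in> trivs G" for c t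
    using assms open_chart_image[OF assms(1), of "fst c" "snd c" "fst t"] that
    by (auto simp: ldom_def vector_bundle_def)
  have inv: "inv_into (fst c) (snd c) y \<in> fst t" 
    if "c \<in> charts G" "t \<in> trivs G" "y \<in> ldom c t" for c t y
  proof -
    have "homeomorphism (fst c) (snd c ` fst c) (snd c) (inv_into (fst c) (snd c))"
      using assms(1) that(1) by (auto simp: compact_manifold_def)
    then show ?thesis using that(3) by (auto simp: ldom_def homeomorphism_def)
  qed
  have lin_add: "snd t x (u + v) = snd t x u + snd t x v" 
    if "t \<in> trivs G" "x \<in> fst t" "u \<in> fibre G x" "v \<in> fibre G x" for t x u v
    using assms(2) that unfolding vector_bundle_def by (cases t) fastforce
  have lin_scl: "snd t x (scl G b u) = b *s snd t x u"
    if "t \<in> trivs G" "x \<in> fst t" "u \<in> fibre G x" for t x u b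
    using assms(2) that unfolding vector_bundle_def by (cases t) fastforce
  have add: "\<phi> + \<psi> \<in> smooth_sections G"
    if \<phi>: "\<phi> \<in> smooth_sections G" and \<psi>: "\<psi> \<in> smooth_sections G" for \<phi> \<psi>
  proof -
    have "Ck_on k (ldom c t) (lrep c t (\<phi> + \<psi>))" if ct: "c \<in> charts G" "t \<in> trivs G" for k c t
    proof (rule Ck_on_cong_open[OF op[OF ct]])
      show "Ck_on k (ldom c t) (\<lambda>y. lrep c t \<phi> y + lrep c t \<psi> y)"
        using \<phi> \<psi> ct by (intro Ck_on_add op) (auto simp: smooth_sections_def smooth_on_def)
      show "lrep c t \<phi> y + lrep c t \<psi> y = lrep c t (\<phi> + \<psi>) y" if "y \<in> ldom c t" for y
        using lin_add[OF ct(2) inv[OF ct that]] \<phi> \<psi> by (simp add: lrep_def smooth_sections_def Let_def)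
    qed
    then show ?thesis
      using \<phi> \<psi> F.subspace_add[OF fib] by (auto simp: smooth_sections_def smooth_on_def)
  qed
  have scale: "sscale G b \<phi> \<in> smooth_sections G" if \<phi>: "\<phi> \<in> smooth_sections G" for b \<phi>
  proof -
    have "Ck_on k (ldom c t) (lrep c t (sscale G b \<phi>))"
      if ct: "c \<in> charts G" "t \<in> trivs G" for k c t
    proof (rule Ck_on_cong_open[OF op[OF ct]])
      show "Ck_on k (ldom c t) (\<lambda>y. b *s lrep c t \<phi> y)"
        using \<phi> ct
        by (intro Ck_on_bounded_linear[OF op bounded_linear_vector_scalar_mult])
          (auto simp: smooth_sections_def smooth_on_def)
      show "b *s lrep c t \<phi> y = lrep c t (sscale G b \<phi>) y" if "y \<in> ldom c t" for y
        using lin_scl[OF ct(2) inv[OF ct that]] \<phi>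
        by (simp add: lrep_def smooth_sections_def sscale_def Let_def)
    qed
    then show ?thesis
      using \<phi> F.subspace_scale[OF fib] by (auto simp: smooth_sections_def smooth_on_def sscale_def)
  qed
  have "0 \<in> smooth_sections G"
  proof -
    have z: "Ck_on k A (\<lambda>y. 0)" for k and A :: "(real^'b) set"
      by (induction k) auto
    have "Ck_on k (ldom c t) (lrep c t 0)" if ct: "c \<in> charts G" "t \<in> trivs G" for k c t
    proof (rule Ck_on_cong_open[OF op[OF ct]])
      show "Ck_on k (ldom c t) (\<lambda>y. 0)" by (rule z)
      show "0 = lrep c t 0 y" if "y \<in> ldom c t" for y
        using lin_scl[OF ct(2) inv[OF ct that], of 0 0] F.subspace_0[OF fib]
        by (simp add: lrep_def Let_def)
    qed
    then show ?thesis
      using F.subspace_0[OF fib] by (auto simp: smooth_sections_def smooth_on_def)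
  qed
  then show ?thesis using add scale unfolding S.subspace_def by blast
qed


section \<open>Eigenspaces for distinct eigenvalues\<close>

text \<open>The usual elimination argument: subtracting \<open>e s\<close> times a vanishing sum from its image under
  \<open>D\<close> removes the summand with index \<open>s\<close> and rescales the others by \<open>e u - e s \<noteq> 0\<close>.  The linearity
  of \<open>D\<close> is confined to a subspace \<open>M\<close>, to fit operators that are specified on smooth sections
  only.\<close>

lemma (in vector_space) eigenvectors_sum_zero:
  assumes "subspace M"
    and add: "\<And>x y. x \<in> M \<Longrightarrow> y \<in> M \<Longrightarrow> D (x + y) = D x + D y"
    and scale: "\<And>c x. x \<in> M \<Longrightarrow> D (scale c x) = scale c (D x)"
    and "finite F"
    and "\<And>t. t \<in> F \<Longrightarrow> v t \<in> M \<and> D (v t) = scale (e t) (v t)"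
    and "inj_on e F" and "(\<Sum>t\<in>F. v t) = 0" and "t \<in> F"
  shows "v t = 0"
  using assms(4-8)
proof (induction F arbitrary: v t)
  case empty
  then show ?case by simp
next
  case (insert s F)
  have vM: "v u \<in> M" if "u \<in> insert s F" for u using insert.prems(1) that by blast
  have D0: "D 0 = 0" using scale[of 0 0] subspace_0[OF assms(1)] by simp
  have D_sum: "D (\<Sum>u\<in>K. v u) = (\<Sum>u\<in>K. D (v u))" if "K \<subseteq> insert s F" "finite K" for K
    using that(2,1)
  proof (induction K)
    case empty
    then show ?case using D0 by simp
  next
    case (insert a K)
    then show ?case using vM subspace_sum[OF assms(1), of K v] add by (simp add: subset_iff)
  qed
  have "0 = D (\<Sum>u\<in>insert s F. v u)" using insert.prems(3) D0 by simp
  also have "\<dots> = (\<Sum>u\<in>insert s F. scale (e u) (v u))"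
    using insert.hyps(1) insert.prems(1) by (subst D_sum) auto
  finally have "(\<Sum>u\<in>insert s F. scale (e u) (v u)) - scale (e s) (\<Sum>u\<in>insert s F. v u) = 0"
    using insert.prems(3) by simp
  then have z: "(\<Sum>u\<in>F. scale (e u - e s) (v u)) = 0"
    using insert.hyps
    by (simp add: scale_sum_right scale_right_distrib scale_left_diff_distrib sum_subtractf)
  have vF: "v u = 0" if "u \<in> F" for u
  proof -
    have "scale (e u - e s) (v u) = 0"
    proof (rule insert.IH[OF _ _ z that])
      show "scale (e w - e s) (v w) \<in> M \<and>
          D (scale (e w - e s) (v w)) = scale (e w) (scale (e w - e s) (v w))" if "w \<in> F" for w
        using insert.prems(1)[of w] that subspace_scale[OF assms(1)] scale
        by (simp add: scale_left_commute)
      show "inj_on e F" using insert.prems(2) by simp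
    qed
    moreover have "e u \<noteq> e s" using insert.prems(2) insert.hyps(2) that by (auto simp: inj_on_def)
    ultimately show ?thesis by simp
  qed
  have "v s = 0" using insert.prems(3) insert.hyps vF by simp
  then show ?case using vF insert.prems(4) by blast
qed

text \<open>Bases of the spaces \<open>E t\<close> are disjoint and have an independent union: a linear relation
  among their elements splits into one eigenvector per eigenvalue, and each of these vanishes.
  Requiring \<open>V\<close> to lie in the span of a finite set is what makes \<^const>\<open>dim\<close> monotone, as it is \<open>0\<close>
  in the infinite-dimensional case.\<close>

lemma (in vector_space) sum_dim_eigenspaces_le:
  assumes "subspace M"
    and add: "\<And>x y. x \<in> M \<Longrightarrow> y \<in> M \<Longrightarrow> D (x + y) = D x + D y"
    and scale: "\<And>c x. x \<in> M \<Longrightarrow> D (scale c x) = scale c (D x)"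
    and "finite F" "inj_on e F"
    and E: "\<And>t x. t \<in> F \<Longrightarrow> x \<in> E t \<Longrightarrow> x \<in> M \<and> D x = scale (e t) x"
    and EV: "\<And>t. t \<in> F \<Longrightarrow> E t \<subseteq> V" and "V \<subseteq> span W" "finite W"
  shows "(\<Sum>t\<in>F. dim (E t)) \<le> dim V"
proof -
  define B where "B t = (SOME b. b \<subseteq> E t \<and> independent b \<and> E t \<subseteq> span b \<and> card b = dim (E t))" for t
  have B: "B t \<subseteq> E t \<and> independent (B t) \<and> E t \<subseteq> span (B t) \<and> card (B t) = dim (E t)" for t
    unfolding B_def by (rule someI_ex) (metis basis_exists)
  have finB: "finite (B t)" if "t \<in> F" for t
    using independent_span_bound[of W "B t"] B EV[OF that] assms(8,9) by blast
  have disj: "B s \<inter> B t = {}" if st: "s \<in> F" "t \<in> F" "s \<noteq> t" for s t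
  proof -
    have False if "x \<in> B s" "x \<in> B t" for x
    proof -
      have "D x = scale (e s) x" "D x = scale (e t) x" using E[OF st(1)] E[OF st(2)] B that by blast+
      then have "scale (e s - e t) x = 0" by (metis scale_left_diff_distrib diff_self)
      moreover have "e s \<noteq> e t" using assms(5) st by (auto simp: inj_on_def)
      ultimately have "x = 0" by simp
      then show False using that B dependent_zero by blast
    qed
    then show ?thesis by blast
  qed
  have "independent (\<Union>t\<in>F. B t)"
  proof (rule independent_if_scalars_zero)
    show "finite (\<Union>t\<in>F. B t)" using assms(4) finB by simp
    fix c x
    assume z: "(\<Sum>x\<in>(\<Union>t\<in>F. B t). scale (c x) x) = 0" and "x \<in> (\<Union>t\<in>F. B t)"
    then obtain t where t: "t \<in> F" "x \<in> B t" by blast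
    have "(\<Sum>t\<in>F. \<Sum>x\<in>B t. scale (c x) x) = 0"
      using z assms(4) finB disj by (subst (asm) sum.UNION_disjoint) auto
    moreover have "(\<Sum>x\<in>B s. scale (c x) x) \<in> M \<and>
        D (\<Sum>x\<in>B s. scale (c x) x) = scale (e s) (\<Sum>x\<in>B s. scale (c x) x)" if s: "s \<in> F" for s
    proof -
      have "(\<Sum>x\<in>K. scale (c x) x) \<in> M \<and>
          D (\<Sum>x\<in>K. scale (c x) x) = scale (e s) (\<Sum>x\<in>K. scale (c x) x)"
        if "finite K" "K \<subseteq> B s" for K
        using that
      proof (induction K)
        case empty
        then show ?case using scale[of 0 0] subspace_0[OF assms(1)] by simp
      next
        case (insert a K)
        then have a: "a \<in> M" "D a = scale (e s) a" using E[OF s] B by blast+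
        then show ?case
          using insert add scale subspace_scale[OF assms(1)] subspace_add[OF assms(1)]
          by (simp add: scale_right_distrib scale_left_commute)
      qed
      then show ?thesis using finB[OF s] by blast
    qed
    ultimately have "(\<Sum>x\<in>B t. scale (c x) x) = 0"
      using eigenvectors_sum_zero[OF assms(1-4), of "\<lambda>t. \<Sum>x\<in>B t. scale (c x) x" e t]
        assms(5) t(1) by blast
    then show "c x = 0" using B independentD finB t by blast
  qed
  moreover have "(\<Union>t\<in>F. B t) \<subseteq> V" using B EV by blast
  moreover obtain b where b: "b \<subseteq> V" "independent b" "V \<subseteq> span b" "card b = dim V"
    using basis_exists by blast
  moreover have "finite b" using b assms(8,9) independent_span_bound[of W b] by blast
  ultimately have "card (\<Union>t\<in>F. B t) \<le> dim V"
    using independent_span_bound[of b "\<Union>t\<in>F. B t"] by auto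
  moreover have "card (\<Union>t\<in>F. B t) = (\<Sum>t\<in>F. card (B t))"
    using assms(4) finB disj by (intro card_UN_disjoint) auto
  ultimately show ?thesis using B by simp
qed


section \<open>The joint eigenspaces\<close>

lemma derivation_zero_at_maximum:
  fixes f :: "'a \<Rightarrow> real"
  assumes "is_flow G T \<theta>" "smooth_fun G f" "\<And>y. f y \<le> f x"
  shows "T f x = 0"
proof -
  have "((\<lambda>s. f (\<theta> s x)) has_real_derivative T f (\<theta> 0 x)) (at 0)" "\<theta> 0 x = x"
    using assms(1,2) unfolding is_flow_def by blast+
  then show ?thesis
    using DERIV_local_max[of "\<lambda>s. f (\<theta> s x)" "T f x" 0 1] assms(3) by simp
qed

text \<open>If \<open>Im \<tau> \<noteq> 0\<close>, the positive function \<open>h(\<phi>,\<phi>)\<close> would grow exponentially in one direction along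
  the flow line through its maximum.\<close>

lemma joint_eigenvalue_real:
  fixes G :: "('a::t2_space, 'n::finite, 'v::ab_group_add, 'k::finite) hbundle"
  assumes G: "hermitian_bundle G" and inv: "metric_invariant G T L" and flow: "is_flow G T \<theta>"
    and \<phi>: "\<phi> \<in> smooth_sections G" "L \<phi> = sscale G (\<i> * \<tau>) \<phi>" and nz: "\<phi> \<noteq> (\<lambda>x. 0)"
  shows "\<tau> \<in> \<real>"
proof -
  have man: "compact_manifold G" and met: "hermitian_metric G" and vb: "vector_bundle G"
    using G by (auto simp: hermitian_bundle_def)
  interpret F: vector_space "scl G" using vb by (simp add: vector_bundle_def)
  have fib: "\<phi> x \<in> fibre G x" for x
    using \<phi>(1) by (simp add: smooth_sections_def)
  have fib': "scl G c (\<phi> x) \<in> fibre G x" for x c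
    using vb fib by (auto simp: vector_bundle_def intro: F.subspace_scale)
  have herm_scl: "\<forall>x. \<forall>u\<in>fibre G x. \<forall>v\<in>fibre G x. \<forall>c.
        herm G x (scl G c u) v = c * herm G x u v"
    and herm_cnj: "\<forall>x. \<forall>u\<in>fibre G x. \<forall>v\<in>fibre G x. herm G x v u = cnj (herm G x u v)"
    and herm_pos: "\<forall>x. \<forall>u\<in>fibre G x. u \<noteq> 0 \<longrightarrow> 0 < Re (herm G x u u)"
    and herm_smooth: "\<forall>\<phi>\<in>smooth_sections G. \<forall>\<psi>\<in>smooth_sections G.
        smooth_fun G (\<lambda>x. herm G x (\<phi> x) (\<psi> x))"
    using met unfolding hermitian_metric_def by blast+
  \<comment> \<open>\<open>h\<close> is real-valued, but the metric invariance speaks of it as a complex function.\<close>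
  define h where "h x = herm G x (\<phi> x) (\<phi> x)" for x
  define f where "f x = Re (h x)" for x
  have f: "smooth_fun G f"
    using smooth_fun_Re[OF man, of h] herm_smooth \<phi>(1)
    by (simp add: f_def[abs_def] h_def[abs_def])
  have herm1: "herm G x (scl G c (\<phi> x)) (\<phi> x) = c * h x"
    and herm2: "herm G x (\<phi> x) (scl G c (\<phi> x)) = cnj (c * h x)" for x c
  proof -
    show *: "herm G x (scl G c (\<phi> x)) (\<phi> x) = c * h x"
      using herm_scl fib by (simp add: h_def)
    have "herm G x (\<phi> x) (scl G c (\<phi> x)) = cnj (herm G x (scl G c (\<phi> x)) (\<phi> x))"
      using herm_cnj fib fib' by blast
    then show "herm G x (\<phi> x) (scl G c (\<phi> x)) = cnj (c * h x)" using * by simp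
  qed
  have hreal: "Im (h x) = 0" for x
  proof -
    have "h x = cnj (h x)" unfolding h_def using herm_cnj fib by blast
    then have "Im (h x) = Im (cnj (h x))" by (rule arg_cong)
    then show ?thesis by simp
  qed
  have "complexify T h = (\<lambda>x. herm G x (L \<phi> x) (\<phi> x) + herm G x (\<phi> x) (L \<phi> x))"
    using inv \<phi>(1) by (simp add: metric_invariant_def h_def[abs_def])
  then have "complexify T h x = (\<i> * \<tau>) * h x + cnj ((\<i> * \<tau>) * h x)" for x
    using herm1 herm2 by (simp add: \<phi>(2) sscale_def)
  then have "Re (complexify T h x) = Re ((\<i> * \<tau>) * h x + cnj ((\<i> * \<tau>) * h x))" for x
    by simp
  then have Tf: "T f x = - 2 * Im \<tau> * f x" for x
    using hreal by (simp add: complexify_def f_def[abs_def])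
  have "compact (UNIV :: 'a set)" using man unfolding compact_manifold_def by blast
  then obtain x where x: "\<And>y. f y \<le> f x"
    using continuous_attains_sup[OF _ _ continuous_smooth_fun[OF man f]] by blast
  obtain z where "\<phi> z \<noteq> 0" using nz by blast
  then have "0 < f z" using herm_pos fib by (simp add: f_def h_def)
  then have "0 < f x" using x[of z] by simp
  moreover have "T f x = 0" using derivation_zero_at_maximum[OF flow f x] .
  ultimately have "Im \<tau> = 0" using Tf[of x] by simp
  then show ?thesis by (simp add: complex_is_Real_iff)
qed

text \<open>On an eigensection of \<open>-\<i>L\<close> with eigenvalue \<open>t\<close>, the summand \<open>(-\<i>L)\<^sup>m\<close> of \<open>A\<close> acts as \<open>t\<^sup>m\<close>,
  and the summand \<open>P\<close> acts as \<open>0\<close>.\<close>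

lemma joint_eigenspace_subset_eigenspace:
  fixes G :: "('a::t2_space, 'n::finite, 'v::ab_group_add, 'k::finite) hbundle"
  assumes vb: "vector_bundle G" and L: "L \<in> diff_ops G l"
  shows "joint_eigenspace G P L (of_real t) \<subseteq> eigenspace G (Aop G m P L) (t ^ m)"
proof
  interpret S: vector_space "sscale G" using vb by (rule vector_space_sscale)
  fix \<phi> assume \<phi>: "\<phi> \<in> joint_eigenspace G P L (of_real t)"
  then have s: "\<phi> \<in> smooth_sections G" and L\<phi>: "L \<phi> = sscale G (\<i> * t) \<phi>" 
    and P\<phi>: "P \<phi> = 0"
    by (auto simp: joint_eigenspace_def zero_fun_def)
  have "(Dop G L ^^ m) \<phi> = sscale G (of_real (t ^ m)) \<phi>"
  proof (induction m)
    case 0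
    then show ?case by simp
  next
    case (Suc m)
    have "L (sscale G (of_real (t ^ m)) \<phi>) = sscale G (of_real (t ^ m)) (L \<phi>)"
      using L s unfolding diff_ops_def by blast
    then show ?case using Suc by (simp add: Dop_def L\<phi> algebra_simps)
  qed
  then show "\<phi> \<in> eigenspace G (Aop G m P L) (t ^ m)"
    using s P\<phi> by (simp add: eigenspace_def Aop_def)
qed


section \<open>Comparison of the counting functions\<close>

text \<open>If \<open>V\<close> is infinite-dimensional, then its \<^const>\<open>edim\<close> is \<open>\<infinity>\<close> and there is nothing to prove;
  otherwise the joint eigenspaces are independent as eigenspaces of \<open>L\<close>.\<close>

lemma sum_edim_joint_eigenspace_le:
  fixes G :: "('a::t2_space, 'n::finite, 'v::ab_group_add, 'k::finite) hbundle"
  assumes G: "hermitian_bundle G" and L: "L \<in> diff_ops G l" and "finite F"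
    and sub: "\<And>\<tau>. \<tau> \<in> F \<Longrightarrow> joint_eigenspace G P L \<tau> \<subseteq> V"
  shows "(\<Sum>\<tau>\<in>F. edim G (joint_eigenspace G P L \<tau>)) \<le> edim G V"
proof -
  have vb: "vector_bundle G" and man: "compact_manifold G"
    using G by (auto simp: hermitian_bundle_def)
  interpret S: vector_space "sscale G" using vb by (rule vector_space_sscale)
  show ?thesis
  proof (cases "\<exists>B. finite B \<and> V \<subseteq> S.span B")
    case True
    then obtain B where B: "finite B" "V \<subseteq> S.span B" by blast
    have "(\<Sum>\<tau>\<in>F. S.dim (joint_eigenspace G P L \<tau>)) \<le> S.dim V"
    proof (rule S.sum_dim_eigenspaces_le[where M="smooth_sections G" and D=L and e="\<lambda>\<tau>. \<i> * \<tau>"])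
      show "S.subspace (smooth_sections G)" by (rule subspace_smooth_sections[OF man vb])
      show "L (x + y) = L x + L y" if "x \<in> smooth_sections G" "y \<in> smooth_sections G" for x y
        using L that unfolding diff_ops_def by blast
      show "L (sscale G c x) = sscale G c (L x)" if "x \<in> smooth_sections G" for c x
        using L that unfolding diff_ops_def by blast
    qed (use assms(3) sub B in \<open>auto simp: joint_eigenspace_def inj_on_def\<close>)
    then have "(\<Sum>\<tau>\<in>F. of_nat (S.dim (joint_eigenspace G P L \<tau>))) \<le> (of_nat (S.dim V) :: ennreal)"
      by (metis of_nat_mono of_nat_sum)
    moreover have "edim G (joint_eigenspace G P L \<tau>) = of_nat (S.dim (joint_eigenspace G P L \<tau>))"
      if "\<tau> \<in> F" for \<tau>
      using B sub[OF that] unfolding edim_def by (meson order_trans)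
    ultimately show ?thesis using B by (auto simp: edim_def)
  next
    case False
    then have "edim G V = \<infinity>" by (simp add: edim_def)
    then show ?thesis by simp
  qed
qed

text \<open>A sum in \<^typ>\<open>ennreal\<close> is the supremum of its finite partial sums, so it suffices to compare
  each finite part \<open>F\<close> of the sum defining \<^const>\<open>N0\<close> with the counting function of \<open>A\<close>.  The fibres of \<open>\<tau> \<mapsto> \<tau>\<^sup>m\<close> group the terms of this
  part by the eigenspace of \<open>A\<close> in which they lie.\<close>

lemma N0_le_eigen_count:
  fixes G :: "('a::t2_space, 'n::finite, 'v::ab_group_add, 'k::finite) hbundle"
  assumes G: "hermitian_bundle G" and L: "L \<in> diff_ops G l"
    and inv: "metric_invariant G T L" and flow: "is_flow G T \<theta>" and "m \<ge> 1"
  shows "N0 G P L \<tau> \<le> eigen_count G (Aop G m P L) (\<tau> ^ m)"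
proof -
  let ?A = "Aop G m P L"
  let ?E = "joint_eigenspace G P L"
  define K where "K = {\<mu>. \<mu> \<in> eigenvalues G ?A \<and> \<mu> < \<tau> ^ m}"
  have vb: "vector_bundle G" using G by (simp add: hermitian_bundle_def)
  interpret S: vector_space "sscale G" using vb by (rule vector_space_sscale)
  have fin: "(\<Sum>\<tau>\<^sub>0\<in>F. edim G (?E \<tau>\<^sub>0)) \<le> eigen_count G ?A (\<tau> ^ m)"
    if F: "finite F" "F \<subseteq> {\<tau>\<^sub>0. \<tau>\<^sub>0 \<in> spec0 G P L \<and> cmod \<tau>\<^sub>0 < \<tau>}" for F
  proof -
    \<comment> \<open>Only these points contribute, and only at these points is \<open>\<tau>\<^sub>0\<close> known to be real.\<close>
    define F' where "F' = {\<tau>\<^sub>0\<in>F. \<not> ?E \<tau>\<^sub>0 \<subseteq> {0}}"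
    have finF': "finite F'" using F(1) by (simp add: F'_def)
    have zero: "edim G (?E \<tau>\<^sub>0) = 0" if "?E \<tau>\<^sub>0 \<subseteq> {0}" for \<tau>\<^sub>0
    proof -
      have "?E \<tau>\<^sub>0 \<subseteq> S.span {}" using that by simp
      moreover from this have "S.dim (?E \<tau>\<^sub>0) = 0" using S.dim_le_card[of _ "{}"] by force
      ultimately show ?thesis unfolding edim_def by (metis finite.emptyI of_nat_0)
    qed
    have real: "\<tau>\<^sub>0 = of_real (Re \<tau>\<^sub>0) \<and> Re \<tau>\<^sub>0 ^ m \<in> K" if \<tau>\<^sub>0: "\<tau>\<^sub>0 \<in> F'" for \<tau>\<^sub>0
    proof -
      obtain \<phi> where \<phi>: "\<phi> \<in> ?E \<tau>\<^sub>0" "\<phi> \<noteq> 0" using \<tau>\<^sub>0 by (auto simp: F'_def)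
      then have "\<tau>\<^sub>0 \<in> \<real>"
        using joint_eigenvalue_real[OF G inv flow, of \<phi> \<tau>\<^sub>0]
        by (auto simp: joint_eigenspace_def zero_fun_def)
      then have eq: "\<tau>\<^sub>0 = of_real (Re \<tau>\<^sub>0)" by simp
      have "\<phi> \<in> eigenspace G ?A (Re \<tau>\<^sub>0 ^ m)"
        using joint_eigenspace_subset_eigenspace[OF vb L, of P "Re \<tau>\<^sub>0" m] \<phi>(1)
        by (subst (asm) eq[symmetric]) blast
      then have "Re \<tau>\<^sub>0 ^ m \<in> eigenvalues G ?A"
        using \<phi>(2) by (auto simp: eigenvalues_def zero_fun_def)
      moreover have "\<bar>Re \<tau>\<^sub>0\<bar> < \<tau>"
        using \<tau>\<^sub>0 F(2) abs_Re_le_cmod[of \<tau>\<^sub>0] by (force simp: F'_def)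
      then have "\<bar>Re \<tau>\<^sub>0\<bar> ^ m < \<tau> ^ m" using assms(5) by (intro power_strict_mono) auto
      then have "Re \<tau>\<^sub>0 ^ m < \<tau> ^ m" by (metis abs_le_D1 le_less_trans order_refl power_abs)
      ultimately show ?thesis using eq by (simp add: K_def)
    qed
    let ?g = "\<lambda>\<tau>\<^sub>0. Re \<tau>\<^sub>0 ^ m"
    have "(\<Sum>\<tau>\<^sub>0\<in>F. edim G (?E \<tau>\<^sub>0)) = (\<Sum>\<tau>\<^sub>0\<in>F'. edim G (?E \<tau>\<^sub>0))"
      using F(1) zero by (intro sum.mono_neutral_right) (auto simp: F'_def)
    also have "\<dots> = (\<Sum>\<mu>\<in>?g ` F'. \<Sum>\<tau>\<^sub>0 | \<tau>\<^sub>0 \<in> F' \<and> ?g \<tau>\<^sub>0 = \<mu>. edim G (?E \<tau>\<^sub>0))"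
      by (rule sum.image_gen[OF finF'])
    also have "\<dots> \<le> (\<Sum>\<mu>\<in>?g ` F'. edim G (eigenspace G ?A \<mu>))"
    proof (intro sum_mono sum_edim_joint_eigenspace_le[OF G L])
      show "finite {\<tau>\<^sub>0 \<in> F'. ?g \<tau>\<^sub>0 = \<mu>}" for \<mu> using finF' by simp
      show "?E \<tau>\<^sub>0 \<subseteq> eigenspace G ?A \<mu>" if "\<tau>\<^sub>0 \<in> {\<tau>\<^sub>0 \<in> F'. ?g \<tau>\<^sub>0 = \<mu>}" for \<tau>\<^sub>0 \<mu>
        using joint_eigenspace_subset_eigenspace[OF vb L, of P "Re \<tau>\<^sub>0" m] real[of \<tau>\<^sub>0] that by auto
    qed
    also have "\<dots> \<le> (\<Sum>\<^sub>\<infinity>\<mu>\<in>K. edim G (eigenspace G ?A \<mu>))"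
    proof -
      have "(\<Sum>\<^sub>\<infinity>\<mu>\<in>?g ` F'. edim G (eigenspace G ?A \<mu>)) \<le> (\<Sum>\<^sub>\<infinity>\<mu>\<in>K. edim G (eigenspace G ?A \<mu>))"
        by (rule infsum_mono_neutral[OF nonneg_summable_on_complete nonneg_summable_on_complete])
          (use real in auto)
      then show ?thesis using finF' by simp
    qed
    finally show ?thesis by (simp add: eigen_count_def K_def)
  qed
  show ?thesis
    unfolding N0_def
    by (rule infsum_le_finite_sums[OF nonneg_summable_on_complete]) (use fin in auto)
qed

theorem theorem3p5:
  fixes G :: "('a::t2_space, 'n::finite, 'v::ab_group_add, 'k::finite) hbundle"
    and T :: "('a \<Rightarrow> real) \<Rightarrow> 'a \<Rightarrow> real"
    and L P :: "('a, 'v) sop"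
    and m :: nat
    and \<Lambda> :: "complex set"
    and w\<^sub>A :: real
  assumes "hermitian_bundle G"
    and "vector_field G T" and "nowhere_vanishing G T"
    and "lie_operator G T L"
    and "m \<ge> 1" and "P \<in> diff_ops G m"
    and "commute_on_smooth G P (formal_adjoint G P)"
    and "commute_on_smooth G P L"
    and "real_line_through_0 \<Lambda>" and "symbol_condition G m P L \<Lambda>"
    and "metric_invariant G T L" and "density_invariant G T"
    and "positive_op G (Aop G m P L)"
    and "weyl_coefficient G m (Aop G m P L) w\<^sub>A"
  shows "(\<forall>\<tau>. N0 G P L \<tau> < \<infinity>) \<and>
    (\<exists>r :: real \<Rightarrow> real. r \<in> o[at_top](\<lambda>\<tau>. \<tau> ^ CARD('n)) \<and>
       (\<forall>\<^sub>F \<tau> in at_top. enn2real (N0 G P L \<tau>) \<le> w\<^sub>A * \<bar>\<tau>\<bar> ^ CARD('n) + r \<tau>))"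
proof -
  let ?A = "Aop G m P L" and ?n = "CARD('n)"
  let ?N = "\<lambda>\<tau>. enn2real (eigen_count G ?A (\<tau> ^ m))"
  obtain \<theta> where flow: "is_flow G T \<theta>"
    using assms(12) by (auto simp: density_invariant_def)
  have L: "L \<in> diff_ops G 1" using assms(4) by (simp add: lie_operator_def)
  have le: "N0 G P L \<tau> \<le> eigen_count G ?A (\<tau> ^ m)" for \<tau>
    by (rule N0_le_eigen_count[OF assms(1) L assms(11) flow assms(5)])
  have fin: "\<And>\<mu>. eigen_count G ?A \<mu> < \<infinity>"
    and weyl: "(\<lambda>\<mu>. enn2real (eigen_count G ?A \<mu>)) \<sim>[at_top]
      (\<lambda>\<mu>. w\<^sub>A * \<mu> powr (real ?n / real m))"
    using assms(14) by (auto simp: weyl_coefficient_def)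
  have "filterlim (\<lambda>\<tau>::real. \<tau> ^ m) at_top at_top"
    using assms(5) by (intro filterlim_pow_at_top filterlim_ident) auto
  then have "?N \<sim>[at_top] (\<lambda>\<tau>. w\<^sub>A * (\<tau> ^ m) powr (real ?n / real m))"
    by (rule asymp_equiv_compose'[OF weyl])
  also have "\<forall>\<^sub>F \<tau> in at_top. w\<^sub>A * (\<tau> ^ m) powr (real ?n / real m) = w\<^sub>A * \<tau> ^ ?n"
    using eventually_gt_at_top[of 0]
  proof eventually_elim
    case (elim \<tau>)
    then have "(\<tau> ^ m) powr (real ?n / real m) = \<tau> powr real ?n"
      using assms(5) by (simp add: powr_powr flip: powr_realpow)
    then show ?case using elim by (simp add: powr_realpow)
  qed
  finally have "(\<lambda>\<tau>. ?N \<tau> - w\<^sub>A * \<tau> ^ ?n) \<in> o[at_top](\<lambda>\<tau>. w\<^sub>A * \<tau> ^ ?n)"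
    by (rule asymp_equiv_imp_diff_smallo)
  then have small: "(\<lambda>\<tau>. ?N \<tau> - w\<^sub>A * \<tau> ^ ?n) \<in> o[at_top](\<lambda>\<tau>. \<tau> ^ ?n)"
    by (rule landau_o.small_big_trans) simp
  have "\<forall>\<^sub>F \<tau> in at_top. enn2real (N0 G P L \<tau>)
      \<le> w\<^sub>A * \<bar>\<tau>\<bar> ^ ?n + (?N \<tau> - w\<^sub>A * \<tau> ^ ?n)"
    using eventually_ge_at_top[of 0]
  proof eventually_elim
    case (elim \<tau>)
    then show ?case using enn2real_mono[OF le] fin by simp
  qed
  then show ?thesis using small le fin by (blast intro: le_less_trans)
qed

end
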